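(* Applicative bisimilarity $\approx$ is a congruence: it is an equivalence relation and its open extension is compatible (preserved by $\lambda x.\cdot$, application, $\mathcal{S}k.\cdot$ and $\langle\cdot\rangle$).
   Context: The calculus $\lambda_S$: terms $t ::= v \mid t\,t \mid \mathcal{S}k.t \mid \langle t\rangle$, values $v ::= x \mid \lambda x.t$. Pure contexts $E ::= \square \mid v\,E \mid E\,t$; evaluation contexts $F ::= \square \mid v\,F \mid F\,t \mid \langle F\rangle$. Reduction: $F[(\lambda x.t)\,v] \to F[t\{v/x\}]$; $F[\langle E[\mathcal{S}k.t]\rangle] \to F[\langle t\{\lambda x.\langle E[x]\rangle/k\}\rangle]$ ($x\notin\mathrm{fv}(E)$); $F[\langle v\rangle]\to F[v]$. Labeled transition system on closed terms, with labels $\tau$, closed values $v$, and closed pure contexts $E$: $(\lambda x.t)\,v \xrightarrow{\tau} t\{v/x\}$; if $t_0\xrightarrow{\tau}t_0'$ then $t_0\,t_1\xrightarrow{\tau}t_0'\,t_1$; if $t\xrightarrow{\tau}t'$ then $v\,t\xrightarrow{\tau}v\,t'$; $\langle v\rangle\xrightarrow{\tau}v$; if $t\xrightarrow{\tau}t'$ then $\langle t\rangle\xrightarrow{\tau}\langle t'\rangle$; if $t\xrightarrow{\square}t'$ then $\langle t\rangle\xrightarrow{\tau}t'$; $\lambda x.t\xrightarrow{v}t\{v/x\}$; $\mathcal{S}k.t\xrightarrow{E}\langle t\{\lambda x.\langle E[x]\rangle/k\}\rangle$ ($x\notin\mathrm{fv}(E)$); if $t_0\xrightarrow{E[\square\,t_1]}t_0'$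 then $t_0\,t_1\xrightarrow{E}t_0'$; if $t\xrightarrow{E[v\,\square]}t'$ then $v\,t\xrightarrow{E}t'$. Weak delay transitions: $\overset{\tau}{\Rightarrow}$ is the reflexive-transitive closure of $\xrightarrow{\tau}$, and for $\alpha\neq\tau$, $\overset{\alpha}{\Rightarrow} = \overset{\tau}{\Rightarrow}\xrightarrow{\alpha}$. A relation $R$ on closed terms is an applicative simulation if $t_0\,R\,t_1$ and $t_0\xrightarrow{\alpha}t_0'$ imply there is $t_1'$ with $t_1\overset{\alpha}{\Rightarrow}t_1'$ and $t_0'\,R\,t_1'$; it is an applicative bisimulation if $R$ and $R^{-1}$ are applicative simulations; applicative bisimilarity $\approx$ is the largest applicative bisimulation. Open extension: for open terms, $t_0\approx^\circ t_1$ iff $t_0\sigma\approx t_1\sigma$ for every substitution $\sigma$ mapping the free variables of $t_0,t_1$ to closed values. *)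

theory Defs
  imports Main
begin

text \<open>Terms are in de Bruijn notation: \<open>Lam\<close> and \<open>Shift\<close> each bind index 0 in their body, so
  syntactic equality is alpha-equivalence. Values are a separate syntactic category, embedded
  into terms by \<open>Val\<close>.\<close>

datatype trm =
    Val val
  | App trm trm
  | Shift trm
  | Reset trm
and val =
    Var nat
  | Lam trm

text \<open>Pure contexts are read from the outside in, as in the grammar
  \<open>E ::= \<box> | v E | E t\<close>.\<close>

datatype pctx =
    Hole
  | AppR val pctx
  | AppL pctx trm

primrec fv_trm :: "trm \<Rightarrow> nat set" and fv_val :: "val \<Rightarrow> nat set" where
  "fv_trm (Val v) = fv_val v"
| "fv_trm (App t u) = fv_trm t \<union> fv_trm u"
| "fv_trm (Shift t) = {n. Suc n \<in> fv_trm t}"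
| "fv_trm (Reset t) = fv_trm t"
| "fv_val (Var n) = {n}"
| "fv_val (Lam t) = {n. Suc n \<in> fv_trm t}"

primrec fv_pctx :: "pctx \<Rightarrow> nat set" where
  "fv_pctx Hole = {}"
| "fv_pctx (AppR v E) = fv_val v \<union> fv_pctx E"
| "fv_pctx (AppL E t) = fv_pctx E \<union> fv_trm t"

definition closed_trm :: "trm \<Rightarrow> bool" where
  "closed_trm t \<longleftrightarrow> fv_trm t = {}"

definition closed_val :: "val \<Rightarrow> bool" where
  "closed_val v \<longleftrightarrow> fv_val v = {}"

definition closed_pctx :: "pctx \<Rightarrow> bool" where
  "closed_pctx E \<longleftrightarrow> fv_pctx E = {}"

definition up_ren :: "(nat \<Rightarrow> nat) \<Rightarrow> nat \<Rightarrow> nat" where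
  "up_ren \<rho> = case_nat 0 (\<lambda>n. Suc (\<rho> n))"

primrec ren_trm :: "(nat \<Rightarrow> nat) \<Rightarrow> trm \<Rightarrow> trm"
    and ren_val :: "(nat \<Rightarrow> nat) \<Rightarrow> val \<Rightarrow> val" where
  "ren_trm \<rho> (Val v) = Val (ren_val \<rho> v)"
| "ren_trm \<rho> (App t u) = App (ren_trm \<rho> t) (ren_trm \<rho> u)"
| "ren_trm \<rho> (Shift t) = Shift (ren_trm (up_ren \<rho>) t)"
| "ren_trm \<rho> (Reset t) = Reset (ren_trm \<rho> t)"
| "ren_val \<rho> (Var n) = Var (\<rho> n)"
| "ren_val \<rho> (Lam t) = Lam (ren_trm (up_ren \<rho>) t)"

primrec ren_pctx :: "(nat \<Rightarrow> nat) \<Rightarrow> pctx \<Rightarrow> pctx" where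
  "ren_pctx \<rho> Hole = Hole"
| "ren_pctx \<rho> (AppR v E) = AppR (ren_val \<rho> v) (ren_pctx \<rho> E)"
| "ren_pctx \<rho> (AppL E t) = AppL (ren_pctx \<rho> E) (ren_trm \<rho> t)"

definition up_subst :: "(nat \<Rightarrow> val) \<Rightarrow> nat \<Rightarrow> val" where
  "up_subst \<sigma> = case_nat (Var 0) (\<lambda>n. ren_val Suc (\<sigma> n))"

primrec subst_trm :: "(nat \<Rightarrow> val) \<Rightarrow> trm \<Rightarrow> trm"
    and subst_val :: "(nat \<Rightarrow> val) \<Rightarrow> val \<Rightarrow> val" where
  "subst_trm \<sigma> (Val v) = Val (subst_val \<sigma> v)"
| "subst_trm \<sigma> (App t u) = App (subst_trm \<sigma> t) (subst_trm \<sigma> u)"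
| "subst_trm \<sigma> (Shift t) = Shift (subst_trm (up_subst \<sigma>) t)"
| "subst_trm \<sigma> (Reset t) = Reset (subst_trm \<sigma> t)"
| "subst_val \<sigma> (Var n) = \<sigma> n"
| "subst_val \<sigma> (Lam t) = Lam (subst_trm (up_subst \<sigma>) t)"

text \<open>\<open>inst t v\<close> is \<open>t{v/x}\<close> for the body \<open>t\<close> of a binder of \<open>x\<close>: index 0 is replaced by \<open>v\<close>
  and the remaining indices are lowered by one.\<close>

definition inst :: "trm \<Rightarrow> val \<Rightarrow> trm" where
  "inst t v = subst_trm (case_nat v Var) t"

primrec plug :: "pctx \<Rightarrow> trm \<Rightarrow> trm" where
  "plug Hole t = t"
| "plug (AppR v E) t = App (Val v) (plug E t)"
| "plug (AppL E u) t = App (plug E t) u"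

text \<open>\<open>comp_pctx E E'\<close> is \<open>E[E']\<close>.\<close>

primrec comp_pctx :: "pctx \<Rightarrow> pctx \<Rightarrow> pctx" where
  "comp_pctx Hole E' = E'"
| "comp_pctx (AppR v E) E' = AppR v (comp_pctx E E')"
| "comp_pctx (AppL E t) E' = AppL (comp_pctx E E') t"

text \<open>The reified context \<open>\<lambda>x. \<langle>E[x]\<rangle>\<close>; weakening \<open>E\<close> by \<open>Suc\<close> ensures \<open>x \<notin> fv(E)\<close>.\<close>

definition reify :: "pctx \<Rightarrow> val" where
  "reify E = Lam (Reset (plug (ren_pctx Suc E) (Val (Var 0))))"

datatype label =
    Tau
  | LVal val
  | LCtx pctx

text \<open>The closedness premises confine the transition system to closed terms and closed labels; rules
  without one inherit it from their premise.\<close>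

inductive lts :: "trm \<Rightarrow> label \<Rightarrow> trm \<Rightarrow> bool" where
  beta: "closed_val (Lam t) \<Longrightarrow> closed_val v \<Longrightarrow>
    lts (App (Val (Lam t)) (Val v)) Tau (inst t v)"
| app_left: "lts t0 Tau t0' \<Longrightarrow> closed_trm t1 \<Longrightarrow> lts (App t0 t1) Tau (App t0' t1)"
| app_right: "lts t Tau t' \<Longrightarrow> closed_val v \<Longrightarrow> lts (App (Val v) t) Tau (App (Val v) t')"
| reset_val: "closed_val v \<Longrightarrow> lts (Reset (Val v)) Tau (Val v)"
| reset_step: "lts t Tau t' \<Longrightarrow> lts (Reset t) Tau (Reset t')"
| reset_capture: "lts t (LCtx Hole) t' \<Longrightarrow> lts (Reset t) Tau t'"
| lam: "closed_val (Lam t) \<Longrightarrow> closed_val v \<Longrightarrow> lts (Val (Lam t)) (LVal v) (inst t v)"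
| shift: "closed_trm (Shift t) \<Longrightarrow> closed_pctx E \<Longrightarrow>
    lts (Shift t) (LCtx E) (Reset (inst t (reify E)))"
| ctx_left: "lts t0 (LCtx (comp_pctx E (AppL Hole t1))) t0' \<Longrightarrow> lts (App t0 t1) (LCtx E) t0'"
| ctx_right: "lts t (LCtx (comp_pctx E (AppR v Hole))) t' \<Longrightarrow> lts (App (Val v) t) (LCtx E) t'"

definition tau_steps :: "trm \<Rightarrow> trm \<Rightarrow> bool" where
  "tau_steps = (\<lambda>t t'. lts t Tau t')\<^sup>*\<^sup>*"

definition weak_lts :: "trm \<Rightarrow> label \<Rightarrow> trm \<Rightarrow> bool" where
  "weak_lts t \<alpha> t' \<longleftrightarrow>
    (if \<alpha> = Tau then tau_steps t t' else (\<exists>u. tau_steps t u \<and> lts u \<alpha> t'))"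

definition app_simulation :: "(trm \<times> trm) set \<Rightarrow> bool" where
  "app_simulation R \<longleftrightarrow>
    R \<subseteq> {t. closed_trm t} \<times> {t. closed_trm t} \<and>
    (\<forall>t0 t1 \<alpha> t0'. (t0, t1) \<in> R \<longrightarrow> lts t0 \<alpha> t0' \<longrightarrow>
      (\<exists>t1'. weak_lts t1 \<alpha> t1' \<and> (t0', t1') \<in> R))"

definition app_bisimulation :: "(trm \<times> trm) set \<Rightarrow> bool" where
  "app_bisimulation R \<longleftrightarrow> app_simulation R \<and> app_simulation (R\<inverse>)"

definition app_bisimilarity :: "(trm \<times> trm) set" where
  "app_bisimilarity = \<Union>{R. app_bisimulation R}"

lemma app_simulation_Union:
  assumes "\<And>R. R \<in> \<R> \<Longrightarrow> app_simulation R"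
  shows "app_simulation (\<Union>\<R>)"
proof -
  have "\<Union>\<R> \<subseteq> {t. closed_trm t} \<times> {t. closed_trm t}"
    using assms unfolding app_simulation_def by blast
  moreover have "\<exists>t1'. weak_lts t1 \<alpha> t1' \<and> (t0', t1') \<in> \<Union>\<R>"
    if "(t0, t1) \<in> \<Union>\<R>" and "lts t0 \<alpha> t0'" for t0 t1 \<alpha> t0'
    using that assms unfolding app_simulation_def by (meson UnionE UnionI)
  ultimately show ?thesis
    unfolding app_simulation_def by blast
qed

lemma app_bisimulation_app_bisimilarity: "app_bisimulation app_bisimilarity"
proof -
  have "app_bisimilarity\<inverse> = \<Union>(converse ` {R. app_bisimulation R})"
    unfolding app_bisimilarity_def by blast
  moreover have "app_simulation (\<Union>(converse ` {R. app_bisimulation R}))"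
    by (rule app_simulation_Union) (auto simp: app_bisimulation_def)
  moreover have "app_simulation app_bisimilarity"
    unfolding app_bisimilarity_def
    by (rule app_simulation_Union) (auto simp: app_bisimulation_def)
  ultimately show ?thesis
    unfolding app_bisimulation_def by simp
qed

lemma app_bisimilarity_greatest: "app_bisimulation R \<Longrightarrow> R \<subseteq> app_bisimilarity"
  unfolding app_bisimilarity_def by blast

text \<open>Only the values of \<open>\<sigma>\<close> on the free variables of the two terms matter.\<close>

definition open_ext :: "(trm \<times> trm) set \<Rightarrow> (trm \<times> trm) set" where
  "open_ext R = {(t0, t1). \<forall>\<sigma>. (\<forall>n \<in> fv_trm t0 \<union> fv_trm t1. closed_val (\<sigma> n)) \<longrightarrow>
    (subst_trm \<sigma> t0, subst_trm \<sigma> t1) \<in> R}"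

definition compatible :: "(trm \<times> trm) set \<Rightarrow> bool" where
  "compatible R \<longleftrightarrow>
    (\<forall>t0 t1. (t0, t1) \<in> R \<longrightarrow> (Val (Lam t0), Val (Lam t1)) \<in> R) \<and>
    (\<forall>t0 t1 u0 u1. (t0, t1) \<in> R \<longrightarrow> (u0, u1) \<in> R \<longrightarrow> (App t0 u0, App t1 u1) \<in> R) \<and>
    (\<forall>t0 t1. (t0, t1) \<in> R \<longrightarrow> (Shift t0, Shift t1) \<in> R) \<and>
    (\<forall>t0 t1. (t0, t1) \<in> R \<longrightarrow> (Reset t0, Reset t1) \<in> R)"

end

theory Submission
  imports Defs
begin

text \<open>
  Howe's method. The Howe closure of \<open>\<approx>\<close> alternates one compatible step with one step of the open
  extension \<open>\<approx>\<degree>\<close>; it is compatible and substitutive by construction, and contains \<open>\<approx>\<degree>\<close>. It is a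
  simulation in a strong sense: a transition with label \<open>\<alpha>\<close> is matched under every label \<open>\<alpha>'\<close>
  related to \<open>\<alpha>\<close>. Varying the label is what makes the induction on transitions go through: a beta
  step \<open>(\<lambda>x.t) v\<close> is matched after the argument \<open>v\<close> has itself been replaced, and a capture by
  \<open>t\<^sub>0 t\<^sub>1\<close> is a capture by \<open>t\<^sub>0\<close> in a context containing the replaced \<open>t\<^sub>1\<close>. Since \<open>\<approx>\<close> is symmetric,
  the transitive closure of the Howe closure is symmetric too, hence a bisimulation; so the Howe
  closure coincides with \<open>\<approx>\<degree>\<close>, which inherits compatibility.
\<close>

section \<open>Substitution\<close>

lemma up_ren_simps [simp]: "up_ren \<rho> 0 = 0" "up_ren \<rho> (Suc n) = Suc (\<rho> n)"
  by (simp_all add: up_ren_def)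

lemma up_subst_simps [simp]: "up_subst \<sigma> 0 = Var 0" "up_subst \<sigma> (Suc n) = ren_val Suc (\<sigma> n)"
  by (simp_all add: up_subst_def)

text \<open>Substitutions are total functions; this makes their values off the free variables
  irrelevant, so that default values may be put there.\<close>

lemma subst_cong_fv:
  "(\<And>n. n \<in> fv_trm t \<Longrightarrow> \<sigma> n = \<tau> n) \<Longrightarrow> subst_trm \<sigma> t = subst_trm \<tau> t"
  "(\<And>n. n \<in> fv_val v \<Longrightarrow> \<sigma> n = \<tau> n) \<Longrightarrow> subst_val \<sigma> v = subst_val \<tau> v"
proof (induction t and v arbitrary: \<sigma> \<tau> and \<sigma> \<tau>)
  case (Val v)
  have "subst_val \<sigma> v = subst_val \<tau> v" using Val.prems by (intro Val.IH) simp
  then show ?case by simp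
next
  case (App t u)
  have "subst_trm \<sigma> t = subst_trm \<tau> t" using App.prems by (intro App.IH(1)) simp
  moreover have "subst_trm \<sigma> u = subst_trm \<tau> u" using App.prems by (intro App.IH(2)) simp
  ultimately show ?case by simp
next
  case (Shift t)
  have "up_subst \<sigma> n = up_subst \<tau> n" if "n \<in> fv_trm t" for n
    using that Shift.prems by (cases n) auto
  then have "subst_trm (up_subst \<sigma>) t = subst_trm (up_subst \<tau>) t" by (rule Shift.IH)
  then show ?case by simp
next
  case (Reset t)
  have "subst_trm \<sigma> t = subst_trm \<tau> t" using Reset.prems by (intro Reset.IH) simp
  then show ?case by simp
next
  case (Var n)
  then show ?case by simp
next
  case (Lam t)
  have "up_subst \<sigma> n = up_subst \<tau> n" if "n \<in> fv_trm t" for n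
    using that Lam.prems by (cases n) auto
  then have "subst_trm (up_subst \<sigma>) t = subst_trm (up_subst \<tau>) t" by (rule Lam.IH)
  then show ?case by simp
qed

lemma up_subst_Var_comp: "up_subst (\<lambda>n. Var (\<rho> n)) = (\<lambda>n. Var (up_ren \<rho> n))"
proof
  fix n show "up_subst (\<lambda>n. Var (\<rho> n)) n = Var (up_ren \<rho> n)" by (cases n) auto
qed

text \<open>Viewing renamings as substitutions lets stability under substitution also give stability
  under renaming, as in \<open>howe_ren\<close>.\<close>

lemma ren_eq_subst:
  "ren_trm \<rho> t = subst_trm (\<lambda>n. Var (\<rho> n)) t"
  "ren_val \<rho> v = subst_val (\<lambda>n. Var (\<rho> n)) v"
  by (induction t and v arbitrary: \<rho> and \<rho>) (simp_all add: up_subst_Var_comp)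

lemma up_subst_Var: "up_subst Var = Var"
proof
  fix n show "up_subst Var n = Var n" by (cases n) auto
qed

lemma subst_Var [simp]: "subst_trm Var t = t" "subst_val Var v = v"
  by (induction t and v) (simp_all add: up_subst_Var)

lemma up_subst_up_ren: "(\<lambda>n. up_subst \<sigma> (up_ren \<rho> n)) = up_subst (\<lambda>n. \<sigma> (\<rho> n))"
proof
  fix n show "up_subst \<sigma> (up_ren \<rho> n) = up_subst (\<lambda>n. \<sigma> (\<rho> n)) n" by (cases n) auto
qed

lemma subst_ren:
  "subst_trm \<sigma> (ren_trm \<rho> t) = subst_trm (\<lambda>n. \<sigma> (\<rho> n)) t"
  "subst_val \<sigma> (ren_val \<rho> v) = subst_val (\<lambda>n. \<sigma> (\<rho> n)) v"
  by (induction t and v arbitrary: \<sigma> \<rho> and \<sigma> \<rho>) (simp_all add: up_subst_up_ren)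

lemma ren_ren: "ren_val \<rho> (ren_val \<rho>' v) = ren_val (\<lambda>n. \<rho> (\<rho>' n)) v"
  by (simp only: ren_eq_subst(2)[of \<rho>] subst_ren) (simp only: ren_eq_subst)

lemma ren_up_subst:
  "(\<lambda>n. ren_val (up_ren \<rho>) (up_subst \<sigma> n)) = up_subst (\<lambda>n. ren_val \<rho> (\<sigma> n))"
proof
  fix n show "ren_val (up_ren \<rho>) (up_subst \<sigma> n) = up_subst (\<lambda>n. ren_val \<rho> (\<sigma> n)) n"
    by (cases n) (simp_all add: ren_ren)
qed

lemma ren_subst:
  "ren_trm \<rho> (subst_trm \<sigma> t) = subst_trm (\<lambda>n. ren_val \<rho> (\<sigma> n)) t"
  "ren_val \<rho> (subst_val \<sigma> v) = subst_val (\<lambda>n. ren_val \<rho> (\<sigma> n)) v"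
  by (induction t and v arbitrary: \<sigma> \<rho> and \<sigma> \<rho>) (simp_all add: ren_up_subst)

text \<open>At a successor index, substituting must commute with the weakening done by
  \<open>up_subst\<close>. This is why \<open>subst_ren\<close> and \<open>ren_subst\<close> come
  before \<open>subst_subst\<close>.\<close>

lemma subst_up_subst:
  "(\<lambda>n. subst_val (up_subst \<tau>) (up_subst \<sigma> n)) = up_subst (\<lambda>n. subst_val \<tau> (\<sigma> n))"
proof
  fix n show "subst_val (up_subst \<tau>) (up_subst \<sigma> n) = up_subst (\<lambda>n. subst_val \<tau> (\<sigma> n)) n"
    by (cases n) (simp_all add: subst_ren ren_subst)
qed

lemma subst_subst:
  "subst_trm \<tau> (subst_trm \<sigma> t) = subst_trm (\<lambda>n. subst_val \<tau> (\<sigma> n)) t"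
  "subst_val \<tau> (subst_val \<sigma> v) = subst_val (\<lambda>n. subst_val \<tau> (\<sigma> n)) v"
  by (induction t and v arbitrary: \<sigma> \<tau> and \<sigma> \<tau>) (simp_all add: subst_up_subst)

section \<open>Free variables under renaming and substitution\<close>

lemma fv_up_ren: "{n. Suc n \<in> up_ren \<rho> ` A} = \<rho> ` {n. Suc n \<in> A}"
proof (intro set_eqI iffI)
  fix n assume "n \<in> {n. Suc n \<in> up_ren \<rho> ` A}"
  then obtain m where "m \<in> A" "Suc n = up_ren \<rho> m" by blast
  then show "n \<in> \<rho> ` {n. Suc n \<in> A}" by (cases m) auto
next
  fix n assume "n \<in> \<rho> ` {n. Suc n \<in> A}"
  then obtain m where "Suc m \<in> A" "Suc n = up_ren \<rho> (Suc m)" by auto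
  then show "n \<in> {n. Suc n \<in> up_ren \<rho> ` A}" by blast
qed

lemma fv_ren:
  "fv_trm (ren_trm \<rho> t) = \<rho> ` fv_trm t"
  "fv_val (ren_val \<rho> v) = \<rho> ` fv_val v"
proof (induction t and v arbitrary: \<rho> and \<rho>)
  case (Shift t)
  then show ?case by (simp only: ren_trm.simps fv_trm.simps fv_up_ren)
next
  case (Lam t)
  then show ?case by (simp only: ren_val.simps fv_val.simps fv_up_ren)
qed (simp_all add: image_Un)

lemma fv_up_subst:
  "{n. Suc n \<in> (\<Union>m\<in>A. fv_val (up_subst \<sigma> m))} = (\<Union>m\<in>{m. Suc m \<in> A}. fv_val (\<sigma> m))"
proof (intro set_eqI iffI)
  fix n assume "n \<in> {n. Suc n \<in> (\<Union>m\<in>A. fv_val (up_subst \<sigma> m))}"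
  then obtain m where "m \<in> A" "Suc n \<in> fv_val (up_subst \<sigma> m)" by blast
  then show "n \<in> (\<Union>m\<in>{m. Suc m \<in> A}. fv_val (\<sigma> m))"
    by (cases m) (auto simp: fv_ren)
next
  fix n assume "n \<in> (\<Union>m\<in>{m. Suc m \<in> A}. fv_val (\<sigma> m))"
  then obtain m where "Suc m \<in> A" "n \<in> fv_val (\<sigma> m)" by blast
  then have "Suc n \<in> fv_val (up_subst \<sigma> (Suc m))" by (simp add: fv_ren)
  with \<open>Suc m \<in> A\<close> show "n \<in> {n. Suc n \<in> (\<Union>m\<in>A. fv_val (up_subst \<sigma> m))}" by blast
qed

lemma fv_subst:
  "fv_trm (subst_trm \<sigma> t) = (\<Union>n\<in>fv_trm t. fv_val (\<sigma> n))"
  "fv_val (subst_val \<sigma> v) = (\<Union>n\<in>fv_val v. fv_val (\<sigma> n))"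
proof (induction t and v arbitrary: \<sigma> and \<sigma>)
  case (Shift t)
  then show ?case by (simp only: subst_trm.simps fv_trm.simps fv_up_subst)
next
  case (Lam t)
  then show ?case by (simp only: subst_val.simps fv_val.simps fv_up_subst)
qed auto

lemma closed_simps [simp]:
  "closed_trm (Val v) \<longleftrightarrow> closed_val v"
  "closed_trm (App t u) \<longleftrightarrow> closed_trm t \<and> closed_trm u"
  "closed_trm (Reset t) \<longleftrightarrow> closed_trm t"
  "\<not> closed_val (Var n)"
  "closed_pctx Hole"
  "closed_pctx (AppR v E) \<longleftrightarrow> closed_val v \<and> closed_pctx E"
  "closed_pctx (AppL E t) \<longleftrightarrow> closed_pctx E \<and> closed_trm t"
  by (auto simp: closed_trm_def closed_val_def closed_pctx_def)

lemma subst_closed: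
  "closed_trm t \<Longrightarrow> subst_trm \<sigma> t = t"
  "closed_val v \<Longrightarrow> subst_val \<sigma> v = v"
  using subst_cong_fv(1)[of t \<sigma> Var] subst_cong_fv(2)[of v \<sigma> Var]
  by (auto simp: closed_trm_def closed_val_def)

lemma closed_subst: "(\<And>n. closed_val (\<sigma> n)) \<Longrightarrow> closed_trm (subst_trm \<sigma> t)"
  by (simp add: closed_trm_def closed_val_def fv_subst)

text \<open>An arbitrary closed value: the default at indices that do not matter, the filler that
  closes intermediate terms, and a test argument for abstractions.\<close>

definition id_val :: val where
  "id_val = Lam (Val (Var 0))"

lemma closed_id_val [simp]: "closed_val id_val"
  by (simp add: id_val_def closed_val_def)

section \<open>Closedness of transitions\<close>

lemma fv_plug: "fv_trm (plug E t) = fv_pctx E \<union> fv_trm t"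
  by (induction E) auto

lemma fv_ren_pctx: "fv_pctx (ren_pctx \<rho> E) = \<rho> ` fv_pctx E"
  by (induction E) (auto simp: fv_ren)

lemma closed_reify: "closed_pctx E \<Longrightarrow> closed_val (reify E)"
  by (simp add: closed_pctx_def closed_val_def reify_def fv_plug fv_ren_pctx)

lemma closed_comp_pctx [simp]:
  "closed_pctx (comp_pctx E E') \<longleftrightarrow> closed_pctx E \<and> closed_pctx E'"
  by (induction E) auto

text \<open>The premise on \<open>t\<close> leaves only index 0 free, which covers the bodies of a
  closed \<open>Lam\<close> and of a closed \<open>Shift\<close> alike.\<close>

lemma closed_inst:
  assumes "\<And>n. Suc n \<notin> fv_trm t" and "closed_val v"
  shows "closed_trm (inst t v)"
proof -
  have "fv_val (case_nat v Var n) = {}" if "n \<in> fv_trm t" for n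
    using that assms by (cases n) (auto simp: closed_val_def)
  then show ?thesis by (simp add: closed_trm_def inst_def fv_subst)
qed

primrec closed_label :: "label \<Rightarrow> bool" where
  "closed_label Tau = True"
| "closed_label (LVal v) = closed_val v"
| "closed_label (LCtx E) = closed_pctx E"

lemma lts_closed:
  "lts t \<alpha> t' \<Longrightarrow> closed_trm t \<and> closed_label \<alpha> \<and> closed_trm t'"
proof (induction rule: lts.induct)
  case (beta t v)
  then show ?case using closed_inst[of t v] by (auto simp: closed_val_def)
next
  case (lam t v)
  then show ?case using closed_inst[of t v] by (auto simp: closed_val_def)
next
  case (shift t E)
  then show ?case using closed_inst[of t "reify E"] closed_reify by (auto simp: closed_trm_def)
qed auto

lemma tau_steps_closed: "tau_steps t t' \<Longrightarrow> closed_trm t \<Longrightarrow> closed_trm t'"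
  unfolding tau_steps_def by (induction rule: rtranclp_induct) (auto dest: lts_closed)

lemma weak_lts_closed: "weak_lts t \<alpha> t' \<Longrightarrow> closed_trm t \<Longrightarrow> closed_trm t'"
  by (auto simp: weak_lts_def tau_steps_closed dest: lts_closed split: if_splits)

section \<open>Weak transitions\<close>

lemma tau_steps_refl [simp]: "tau_steps t t"
  by (simp add: tau_steps_def)

lemma tau_steps_trans: "tau_steps t u \<Longrightarrow> tau_steps u v \<Longrightarrow> tau_steps t v"
  unfolding tau_steps_def by (rule rtranclp_trans)

lemma tau_steps_step: "lts t Tau u \<Longrightarrow> tau_steps t u"
  unfolding tau_steps_def by (rule r_into_rtranclp)

lemma tau_steps_map:
  assumes "tau_steps t t'" and "\<And>t t'. lts t Tau t' \<Longrightarrow> lts (f t) Tau (f t')"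
  shows "tau_steps (f t) (f t')"
  using assms(1) unfolding tau_steps_def
  by (induction rule: rtranclp_induct) (auto intro: assms(2) rtranclp.rtrancl_into_rtrancl)

lemma tau_steps_App_left:
  "tau_steps t t' \<Longrightarrow> closed_trm u \<Longrightarrow> tau_steps (App t u) (App t' u)"
  by (rule tau_steps_map[where f = "\<lambda>t. App t u"]) (auto intro: lts.intros)

lemma tau_steps_App_right:
  "tau_steps t t' \<Longrightarrow> closed_val v \<Longrightarrow> tau_steps (App (Val v) t) (App (Val v) t')"
  by (rule tau_steps_map[where f = "App (Val v)"]) (auto intro: lts.intros)

lemma tau_steps_Reset: "tau_steps t t' \<Longrightarrow> tau_steps (Reset t) (Reset t')"
  by (rule tau_steps_map[where f = Reset]) (auto intro: lts.intros)

text \<open>Evaluation goes from left to right: \<open>u\<close> may move only after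
  \<open>t\<close> has become a value, so the two runs are concatenated in this order.\<close>

lemma tau_steps_App_vals:
  assumes "tau_steps t (Val v)" and "tau_steps u u'" and "closed_trm t" and "closed_trm u"
  shows "tau_steps (App t u) (App (Val v) u')"
  using tau_steps_closed[OF assms(1,3)] tau_steps_App_left[OF assms(1,4)]
    tau_steps_App_right[OF assms(2)] tau_steps_trans by (metis closed_simps(1))

lemma Val_no_tau: "\<not> lts (Val v) Tau t"
  by (auto elim: lts.cases)

lemma tau_steps_Val: "tau_steps (Val v) t \<Longrightarrow> t = Val v"
  unfolding tau_steps_def by (auto elim: converse_rtranclpE simp: Val_no_tau)

lemma weak_lts_simps [simp]:
  "weak_lts t Tau t' \<longleftrightarrow> tau_steps t t'"
  "weak_lts t (LVal v) t' \<longleftrightarrow> (\<exists>u. tau_steps t u \<and> lts u (LVal v) t')"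
  "weak_lts t (LCtx E) t' \<longleftrightarrow> (\<exists>u. tau_steps t u \<and> lts u (LCtx E) t')"
  by (simp_all add: weak_lts_def)

lemma tau_steps_weak_lts: "tau_steps t u \<Longrightarrow> weak_lts u \<alpha> t' \<Longrightarrow> weak_lts t \<alpha> t'"
  by (cases \<alpha>) (auto intro: tau_steps_trans)

section \<open>Simulations along weak transitions and under composition\<close>

lemma app_simulation_tau_steps:
  assumes "app_simulation R" and "tau_steps t t'" and "(t, u) \<in> R"
  shows "\<exists>u'. tau_steps u u' \<and> (t', u') \<in> R"
  using assms(2) unfolding tau_steps_def
proof (induction rule: rtranclp_induct)
  case base
  then show ?case using assms(3) by blast
next
  case (step y z)
  then obtain u' where u': "tau_steps u u'" "(y, u') \<in> R" by (auto simp: tau_steps_def)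
  obtain u'' where "weak_lts u' Tau u''" "(z, u'') \<in> R"
    using assms(1) step(2) u'(2) unfolding app_simulation_def by blast
  then show ?case using u'(1) tau_steps_trans by (auto simp flip: tau_steps_def)
qed

text \<open>Composition of simulations relies on this: the first relation answers a step by a weak
  transition, which the second one must then follow.\<close>

lemma app_simulation_weak_lts:
  assumes "app_simulation R" and "weak_lts t \<alpha> t'" and "(t, u) \<in> R"
  shows "\<exists>u'. weak_lts u \<alpha> u' \<and> (t', u') \<in> R"
proof (cases "\<alpha> = Tau")
  case True
  then show ?thesis using app_simulation_tau_steps[OF assms(1) _ assms(3)] assms(2) by simp
next
  case False
  then obtain s where s: "tau_steps t s" "lts s \<alpha> t'" using assms(2) by (auto simp: weak_lts_def)
  obtain r where r: "tau_steps u r" "(s, r) \<in> R"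
    using app_simulation_tau_steps[OF assms(1) s(1) assms(3)] by blast
  obtain u' where "weak_lts r \<alpha> u'" "(t', u') \<in> R"
    using assms(1) s(2) r(2) unfolding app_simulation_def by blast
  then show ?thesis using tau_steps_weak_lts[OF r(1)] by blast
qed

lemma app_simulation_relcomp:
  assumes "app_simulation R" and "app_simulation S"
  shows "app_simulation (R O S)"
  unfolding app_simulation_def
proof (intro conjI allI impI)
  show "R O S \<subseteq> {t. closed_trm t} \<times> {t. closed_trm t}"
    using assms unfolding app_simulation_def by blast
next
  fix t0 t1 \<alpha> t0' assume "(t0, t1) \<in> R O S" and step: "lts t0 \<alpha> t0'"
  then obtain s where s: "(t0, s) \<in> R" "(s, t1) \<in> S" by blast
  obtain s' where "weak_lts s \<alpha> s'" "(t0', s') \<in> R"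
    using assms(1) s(1) step unfolding app_simulation_def by blast
  then show "\<exists>t1'. weak_lts t1 \<alpha> t1' \<and> (t0', t1') \<in> R O S"
    using app_simulation_weak_lts[OF assms(2) _ s(2)] by blast
qed

lemma app_simulation_trancl:
  assumes "app_simulation R"
  shows "app_simulation (R\<^sup>+)"
proof -
  have "app_simulation (R ^^ Suc n)" for n
    by (induction n) (use assms app_simulation_relcomp in auto)
  then have "app_simulation (\<Union>(range (\<lambda>n. R ^^ Suc n)))"
    by (intro app_simulation_Union) auto
  moreover have "\<Union>(range (\<lambda>n. R ^^ Suc n)) = R\<^sup>+"
  proof (intro set_eqI iffI; clarify)
    fix a b n assume "(a, b) \<in> R ^^ Suc n"
    then show "(a, b) \<in> R\<^sup>+" unfolding trancl_power by blast
  next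
    fix a b assume "(a, b) \<in> R\<^sup>+"
    then obtain n where "n > 0" "(a, b) \<in> R ^^ n" unfolding trancl_power by blast
    then show "(a, b) \<in> \<Union>(range (\<lambda>n. R ^^ Suc n))" by (metis UN_I UNIV_I gr0_conv_Suc)
  qed
  ultimately show ?thesis by simp
qed

section \<open>Applicative bisimilarity is an equivalence\<close>

lemma bisim_simulation: "app_simulation app_bisimilarity"
  using app_bisimulation_app_bisimilarity by (simp add: app_bisimulation_def)

lemma bisim_closed: "(t, u) \<in> app_bisimilarity \<Longrightarrow> closed_trm t \<and> closed_trm u"
  using bisim_simulation unfolding app_simulation_def by blast

lemma bisim_refl: "closed_trm t \<Longrightarrow> (t, t) \<in> app_bisimilarity"
proof -
  have "app_simulation {(t, t) |t. closed_trm t}"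
    unfolding app_simulation_def
  proof (intro conjI allI impI)
    fix t0 t1 \<alpha> t0' assume "(t0, t1) \<in> {(t, t) |t. closed_trm t}" and step: "lts t0 \<alpha> t0'"
    moreover have "weak_lts t0 \<alpha> t0'" using step
      by (cases \<alpha>) (auto intro: tau_steps_step tau_steps_refl)
    ultimately show "\<exists>t1'. weak_lts t1 \<alpha> t1' \<and> (t0', t1') \<in> {(t, t) |t. closed_trm t}"
      using lts_closed by blast
  qed auto
  moreover have "{(t, t) |t. closed_trm t}\<inverse> = {(t, t) |t. closed_trm t}" by auto
  ultimately have "app_bisimulation {(t, t) |t. closed_trm t}"
    by (simp add: app_bisimulation_def)
  then show "closed_trm t \<Longrightarrow> (t, t) \<in> app_bisimilarity"
    using app_bisimilarity_greatest by blast
qed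

lemma bisim_sym: "(t, u) \<in> app_bisimilarity \<Longrightarrow> (u, t) \<in> app_bisimilarity"
proof -
  have "app_bisimulation (app_bisimilarity\<inverse>)"
    using app_bisimulation_app_bisimilarity by (simp add: app_bisimulation_def)
  then show "(t, u) \<in> app_bisimilarity \<Longrightarrow> (u, t) \<in> app_bisimilarity"
    using app_bisimilarity_greatest by blast
qed

lemma bisim_trans:
  assumes "(t, u) \<in> app_bisimilarity" and "(u, v) \<in> app_bisimilarity"
  shows "(t, v) \<in> app_bisimilarity"
proof -
  have "app_bisimulation (app_bisimilarity O app_bisimilarity)"
    using app_bisimulation_app_bisimilarity
    by (simp add: app_bisimulation_def app_simulation_relcomp converse_relcomp)
  then show ?thesis using app_bisimilarity_greatest assms by blast
qed

lemma equiv_bisim: "equiv {t. closed_trm t} app_bisimilarity"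
  by (rule equivI)
    (auto intro!: refl_onI symI transI dest: bisim_closed intro: bisim_refl bisim_sym bisim_trans)

text \<open>Answering a \<open>\<lambda>\<close>-abstraction only provides some reachable abstraction with bisimilar instances;
  that the abstraction itself is bisimilar needs the converse simulation and that values are
  \<open>\<tau>\<close>-normal.\<close>

lemma bisim_Lam:
  assumes "(Val (Lam t), u) \<in> app_bisimilarity"
  shows "\<exists>s. tau_steps u (Val (Lam s)) \<and> (Val (Lam t), Val (Lam s)) \<in> app_bisimilarity"
proof -
  have "closed_val (Lam t)" using bisim_closed[OF assms] by simp
  then have "lts (Val (Lam t)) (LVal id_val) (inst t id_val)" by (simp add: lts.lam)
  then obtain u' r where r: "tau_steps u r" "lts r (LVal id_val) u'"
    using bisim_simulation assms unfolding app_simulation_def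
    by (metis weak_lts_simps(2))
  obtain s where s: "r = Val (Lam s)" using r(2) by (auto elim: lts.cases)
  obtain t' where "tau_steps (Val (Lam t)) t'" "(r, t') \<in> app_bisimilarity"
    using app_simulation_tau_steps[OF bisim_simulation r(1) bisim_sym[OF assms]] by blast
  then show ?thesis using r(1) s bisim_sym tau_steps_Val by blast
qed

text \<open>The answer starts with \<tau>-steps, but a value has none, so it is the instance of this
  very abstraction.\<close>

lemma bisim_Lam_inst:
  assumes "(Val (Lam t), Val (Lam s)) \<in> app_bisimilarity" and "closed_val v"
  shows "(inst t v, inst s v) \<in> app_bisimilarity"
proof -
  have "lts (Val (Lam t)) (LVal v) (inst t v)"
    using bisim_closed[OF assms(1)] assms(2) by (simp add: lts.lam)
  then obtain s' r where "tau_steps (Val (Lam s)) r" "lts r (LVal v) s'"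
      "(inst t v, s') \<in> app_bisimilarity"
    using bisim_simulation assms(1) unfolding app_simulation_def
    by (metis weak_lts_simps(2))
  then show ?thesis by (auto dest!: tau_steps_Val elim: lts.cases)
qed

section \<open>The open extension\<close>

abbreviation obisim :: "trm \<Rightarrow> trm \<Rightarrow> bool" (infix "\<approx>\<degree>" 50) where
  "t \<approx>\<degree> u \<equiv> (t, u) \<in> open_ext app_bisimilarity"

text \<open>Substitutions closed at every index remain so after composition with any substitution,
  which makes this form convenient for \<open>obisim_subst\<close>.\<close>

lemma open_ext_iff:
  "(t, u) \<in> open_ext R \<longleftrightarrow>
    (\<forall>\<sigma>. (\<forall>n. closed_val (\<sigma> n)) \<longrightarrow> (subst_trm \<sigma> t, subst_trm \<sigma> u) \<in> R)"
proof
  assume "(t, u) \<in> open_ext R"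
  then show "\<forall>\<sigma>. (\<forall>n. closed_val (\<sigma> n)) \<longrightarrow> (subst_trm \<sigma> t, subst_trm \<sigma> u) \<in> R"
    by (simp add: open_ext_def)
next
  assume *: "\<forall>\<sigma>. (\<forall>n. closed_val (\<sigma> n)) \<longrightarrow> (subst_trm \<sigma> t, subst_trm \<sigma> u) \<in> R"
  have "(subst_trm \<sigma> t, subst_trm \<sigma> u) \<in> R"
    if \<sigma>: "\<forall>n \<in> fv_trm t \<union> fv_trm u. closed_val (\<sigma> n)" for \<sigma>
  proof -
    \<comment> \<open>\<open>\<tau>\<close> agrees with \<open>\<sigma>\<close> on the free
      variables of both terms and is closed everywhere.\<close>
    define \<tau> where "\<tau> n = (if closed_val (\<sigma> n) then \<sigma> n else id_val)" for n
    have "subst_trm \<tau> t = subst_trm \<sigma> t" "subst_trm \<tau> u = subst_trm \<sigma> u"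
      using \<sigma> by (auto intro!: subst_cong_fv simp: \<tau>_def)
    moreover have "closed_val (\<tau> n)" for n by (simp add: \<tau>_def)
    ultimately show ?thesis using * by metis
  qed
  then show "(t, u) \<in> open_ext R" by (simp add: open_ext_def)
qed

lemma obisim_refl: "t \<approx>\<degree> t"
  by (simp add: open_ext_iff bisim_refl closed_subst)

lemma obisim_sym: "t \<approx>\<degree> u \<Longrightarrow> u \<approx>\<degree> t"
  unfolding open_ext_iff using bisim_sym by blast

lemma obisim_trans: "t \<approx>\<degree> u \<Longrightarrow> u \<approx>\<degree> v \<Longrightarrow> t \<approx>\<degree> v"
  unfolding open_ext_iff using bisim_trans by blast

lemma closed_subst_val: "(\<And>n. closed_val (\<sigma> n)) \<Longrightarrow> closed_val (subst_val \<sigma> v)"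
  by (simp add: closed_val_def fv_subst)

text \<open>Here \<open>\<sigma>\<close> may have open values: following it by a closing
  substitution gives a closing substitution again.\<close>

lemma obisim_subst: "t \<approx>\<degree> u \<Longrightarrow> subst_trm \<sigma> t \<approx>\<degree> subst_trm \<sigma> u"
  by (simp add: open_ext_iff subst_subst closed_subst_val)

lemma obisim_closed_iff:
  "closed_trm t \<Longrightarrow> closed_trm u \<Longrightarrow> t \<approx>\<degree> u \<longleftrightarrow> (t, u) \<in> app_bisimilarity"
  by (auto simp: open_ext_iff subst_closed intro: exI[of _ "\<lambda>_. id_val"])

section \<open>The Howe closure\<close>

text \<open>Each rule ends in one \<open>\<approx>\<degree>\<close> step, so further such steps are
  absorbed on the right (\<open>howe_obisim\<close>). The left side has no such step built in, hence
  the asymmetry repaired later by the transitive closure.\<close>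

inductive howe :: "trm \<Rightarrow> trm \<Rightarrow> bool" where
  Var: "Val (Var n) \<approx>\<degree> u \<Longrightarrow> howe (Val (Var n)) u"
| Lam: "howe t t' \<Longrightarrow> Val (Lam t') \<approx>\<degree> u \<Longrightarrow> howe (Val (Lam t)) u"
| App: "howe t t' \<Longrightarrow> howe s s' \<Longrightarrow> App t' s' \<approx>\<degree> u \<Longrightarrow> howe (App t s) u"
| Shift: "howe t t' \<Longrightarrow> Shift t' \<approx>\<degree> u \<Longrightarrow> howe (Shift t) u"
| Reset: "howe t t' \<Longrightarrow> Reset t' \<approx>\<degree> u \<Longrightarrow> howe (Reset t) u"

lemma howe_compat:
  "howe t t' \<Longrightarrow> howe (Val (Lam t)) (Val (Lam t'))"
  "howe t t' \<Longrightarrow> howe s s' \<Longrightarrow> howe (App t s) (App t' s')"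
  "howe t t' \<Longrightarrow> howe (Shift t) (Shift t')"
  "howe t t' \<Longrightarrow> howe (Reset t) (Reset t')"
  by (auto intro: howe.intros obisim_refl)

lemma howe_refl: "howe t t" "howe (Val v) (Val v)"
proof (induction t and v)
  case (Var n)
  then show ?case by (simp add: howe.Var obisim_refl)
qed (auto intro: howe_compat)

lemma howe_obisim: "howe t u \<Longrightarrow> u \<approx>\<degree> v \<Longrightarrow> howe t v"
  by (induction arbitrary: v rule: howe.induct) (auto intro: howe.intros obisim_trans)

lemma obisim_howe: "t \<approx>\<degree> u \<Longrightarrow> howe t u"
  using howe_obisim howe_refl by blast

text \<open>Needed before \<open>howe_subst\<close>, because \<open>up_subst\<close> weakens the
  substituted values under a binder.\<close>

lemma howe_ren: "howe t u \<Longrightarrow> howe (ren_trm \<rho> t) (ren_trm \<rho> u)"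
proof (induction arbitrary: \<rho> rule: howe.induct)
  case (Var n u)
  then show ?case
    using obisim_subst[OF Var, of "\<lambda>n. Var (\<rho> n)"] by (simp add: obisim_howe ren_eq_subst)
next
  case (Lam t t' u)
  have "ren_trm \<rho> (Val (Lam t')) \<approx>\<degree> ren_trm \<rho> u"
    using obisim_subst[OF Lam(2)] by (simp only: ren_eq_subst)
  then show ?case using Lam.IH by (auto intro: howe.Lam)
next
  case (App t t' s s' u)
  have "ren_trm \<rho> (App t' s') \<approx>\<degree> ren_trm \<rho> u"
    using obisim_subst[OF App(3)] by (simp only: ren_eq_subst)
  then show ?case using App.IH by (auto intro: howe.App)
next
  case (Shift t t' u)
  have "ren_trm \<rho> (Shift t') \<approx>\<degree> ren_trm \<rho> u"
    using obisim_subst[OF Shift(2)] by (simp only: ren_eq_subst)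
  then show ?case using Shift.IH by (auto intro: howe.Shift)
next
  case (Reset t t' u)
  have "ren_trm \<rho> (Reset t') \<approx>\<degree> ren_trm \<rho> u"
    using obisim_subst[OF Reset(2)] by (simp only: ren_eq_subst)
  then show ?case using Reset.IH by (auto intro: howe.Reset)
qed

lemma howe_up_subst:
  assumes "\<And>n. howe (Val (\<sigma> n)) (Val (\<sigma>' n))"
  shows "howe (Val (up_subst \<sigma> n)) (Val (up_subst \<sigma>' n))"
  using howe_refl howe_ren[OF assms, of Suc] by (cases n) auto

text \<open>Both sides are substituted at once by related values. The compatible part uses
  \<open>\<sigma>\<close> on the left and \<open>\<sigma>'\<close> on the right, while the final
  \<open>\<approx>\<degree>\<close> step is instantiated by \<open>\<sigma>'\<close> alone.\<close>

lemma howe_subst: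
  "howe t u \<Longrightarrow> (\<And>n. howe (Val (\<sigma> n)) (Val (\<sigma>' n))) \<Longrightarrow>
    howe (subst_trm \<sigma> t) (subst_trm \<sigma>' u)"
proof (induction arbitrary: \<sigma> \<sigma>' rule: howe.induct)
  case (Var n u)
  then show ?case using obisim_subst[OF Var(1), of \<sigma>'] howe_obisim by force
next
  case (Lam t t' u)
  then have "howe (subst_trm (up_subst \<sigma>) t) (subst_trm (up_subst \<sigma>') t')"
    using howe_up_subst by blast
  then show ?case using obisim_subst[OF Lam(2), of \<sigma>'] by (auto intro: howe.Lam)
next
  case (App t t' s s' u)
  have "howe (subst_trm \<sigma> t) (subst_trm \<sigma>' t')" "howe (subst_trm \<sigma> s) (subst_trm \<sigma>' s')"
    by (rule App.IH; rule App.prems)+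
  then show ?case using obisim_subst[OF App(3), of \<sigma>'] by (auto intro: howe.App)
next
  case (Shift t t' u)
  then have "howe (subst_trm (up_subst \<sigma>) t) (subst_trm (up_subst \<sigma>') t')"
    using howe_up_subst by blast
  then show ?case using obisim_subst[OF Shift(2), of \<sigma>'] by (auto intro: howe.Shift)
next
  case (Reset t t' u)
  have "howe (subst_trm \<sigma> t) (subst_trm \<sigma>' t')" by (rule Reset.IH) (rule Reset.prems)
  then show ?case using obisim_subst[OF Reset(2), of \<sigma>'] by (auto intro: howe.Reset)
qed

lemma howe_inst:
  assumes "howe t u" and "howe (Val v) (Val w)"
  shows "howe (inst t v) (inst u w)"
proof -
  have "howe (Val (case_nat v Var n)) (Val (case_nat w Var n))" for n
    using assms(2) howe_refl by (cases n) auto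
  then show ?thesis unfolding inst_def using howe_subst[OF assms(1)] by blast
qed

text \<open>The intermediate term in a Howe step between closed terms may be open; instantiating its free
  variables by \<open>id_val\<close> makes it closed.\<close>

lemma howe_close: "howe t u \<Longrightarrow> howe (subst_trm (\<lambda>_. id_val) t) (subst_trm (\<lambda>_. id_val) u)"
  using howe_subst howe_refl by blast

text \<open>Under a binder index 0 must stay free, hence the lifted substitution: it fixes index 0,
  so \<open>t\<close> is unchanged, and it closes every other index of \<open>u\<close>.\<close>

lemma howe_close_up:
  assumes "howe t u" and "\<And>n. Suc n \<notin> fv_trm t"
  shows "howe t (subst_trm (up_subst (\<lambda>_. id_val)) u)"
proof -
  have "up_subst (\<lambda>_. id_val) n = Var n" if "n \<in> fv_trm t" for n
    using that assms(2) by (cases n) auto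
  then have "subst_trm (up_subst (\<lambda>_. id_val)) t = t"
    using subst_cong_fv(1)[of t _ Var] by simp
  then show ?thesis using howe_subst[OF assms(1)] howe_refl by metis
qed

lemma obisim_close:
  assumes "t \<approx>\<degree> u" and "closed_trm u"
  shows "(subst_trm (\<lambda>_. id_val) t, u) \<in> app_bisimilarity"
  using assms subst_closed(1)[OF assms(2)] unfolding open_ext_iff by (metis closed_id_val)

text \<open>This and the next three inversions choose the intermediate term closed, so that the last
  step is bisimilarity itself and can be played as a simulation.\<close>

lemma howe_closed_LamE:
  assumes "howe (Val (Lam t)) u" and "closed_val (Lam t)" and "closed_trm u"
  obtains t' where "howe t t'" and "(Val (Lam t'), u) \<in> app_bisimilarity"
  using assms(1)
proof cases
  case (Lam t')
  have "howe t (subst_trm (up_subst (\<lambda>_. id_val)) t')"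
    using howe_close_up Lam(1) assms(2) by (auto simp: closed_val_def)
  then show ?thesis using obisim_close[OF Lam(2) assms(3)] that by simp
qed

lemma howe_closed_ShiftE:
  assumes "howe (Shift t) u" and "closed_trm (Shift t)" and "closed_trm u"
  obtains t' where "howe t t'" and "(Shift t', u) \<in> app_bisimilarity"
  using assms(1)
proof cases
  case (Shift t')
  have "howe t (subst_trm (up_subst (\<lambda>_. id_val)) t')"
    using howe_close_up Shift(1) assms(2) by (auto simp: closed_trm_def)
  then show ?thesis using obisim_close[OF Shift(2) assms(3)] that by simp
qed

lemma howe_closed_AppE:
  assumes "howe (App t s) u" and "closed_trm (App t s)" and "closed_trm u"
  obtains t' s' where "howe t t'" and "howe s s'" and "closed_trm t'" and "closed_trm s'"
    and "(App t' s', u) \<in> app_bisimilarity"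
  using assms(1)
proof cases
  case (App t' s')
  have "(App (subst_trm (\<lambda>_. id_val) t') (subst_trm (\<lambda>_. id_val) s'), u) \<in> app_bisimilarity"
    using obisim_close[OF App(3) assms(3)] by simp
  then show ?thesis
    using that howe_close[OF App(1)] howe_close[OF App(2)] assms(2)
    by (simp add: subst_closed closed_subst)
qed

lemma howe_closed_ResetE:
  assumes "howe (Reset t) u" and "closed_trm (Reset t)" and "closed_trm u"
  obtains t' where "howe t t'" and "closed_trm t'" and "(Reset t', u) \<in> app_bisimilarity"
  using assms(1)
proof cases
  case (Reset t')
  have "(Reset (subst_trm (\<lambda>_. id_val) t'), u) \<in> app_bisimilarity"
    using obisim_close[OF Reset(2) assms(3)] by simp
  then show ?thesis
    using that howe_close[OF Reset(1)] assms(2) by (simp add: subst_closed closed_subst)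
qed

lemma howe_bisim: "howe t u \<Longrightarrow> (u, v) \<in> app_bisimilarity \<Longrightarrow> howe t v"
  using howe_obisim obisim_closed_iff bisim_closed by blast

text \<open>The abstraction \<open>s\<close> is fixed before \<open>v\<close> and \<open>w\<close>.
  A beta step needs this uniformity, since there the replacement of the argument is found
  separately. It holds because \<open>bisim_Lam\<close> relates the abstractions themselves and not
  just one instance.\<close>

lemma howe_Lam:
  assumes "howe (Val (Lam t)) u" and "closed_val (Lam t)" and "closed_trm u"
  obtains s where "tau_steps u (Val (Lam s))" and "closed_val (Lam s)"
    and "howe (Val (Lam t)) (Val (Lam s))"
    and "\<And>v w. howe (Val v) (Val w) \<Longrightarrow> closed_val w \<Longrightarrow> howe (inst t v) (inst s w)"
proof -
  obtain t' where t': "howe t t'" "(Val (Lam t'), u) \<in> app_bisimilarity"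
    using howe_closed_LamE[OF assms] .
  obtain s where s: "tau_steps u (Val (Lam s))" "(Val (Lam t'), Val (Lam s)) \<in> app_bisimilarity"
    using bisim_Lam[OF t'(2)] by blast
  show ?thesis
  proof (rule that)
    show "closed_val (Lam s)" using bisim_closed[OF s(2)] by simp
    show "howe (Val (Lam t)) (Val (Lam s))" using howe_bisim howe_compat(1) t'(1) s(2) by blast
    show "howe (inst t v) (inst s w)" if "howe (Val v) (Val w)" "closed_val w" for v w
      using howe_inst[OF t'(1) that(1)] bisim_Lam_inst[OF s(2) that(2)] howe_bisim by blast
  qed (rule s(1))
qed

lemma howe_Val:
  assumes "howe (Val v) u" and "closed_val v" and "closed_trm u"
  obtains w where "tau_steps u (Val w)" and "closed_val w" and "howe (Val v) (Val w)"
  using assms by (cases v) (auto elim: howe_Lam)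

section \<open>The Howe closure is a simulation\<close>

text \<open>Contexts of the same shape related frame by frame; this suffices for
  \<open>howe_reify\<close>, which follows by compatibility.\<close>

inductive howe_pctx :: "pctx \<Rightarrow> pctx \<Rightarrow> bool" where
  Hole: "howe_pctx Hole Hole"
| AppR: "howe (Val v) (Val w) \<Longrightarrow> howe_pctx E E' \<Longrightarrow> howe_pctx (AppR v E) (AppR w E')"
| AppL: "howe_pctx E E' \<Longrightarrow> howe t u \<Longrightarrow> howe_pctx (AppL E t) (AppL E' u)"

lemma howe_pctx_refl: "howe_pctx E E"
  by (induction E) (auto intro: howe_pctx.intros howe_refl)

lemma howe_pctx_comp:
  "howe_pctx E E' \<Longrightarrow> howe_pctx D D' \<Longrightarrow> howe_pctx (comp_pctx E D) (comp_pctx E' D')"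
  by (induction rule: howe_pctx.induct) (auto intro: howe_pctx.intros)

lemma howe_plug_ren:
  "howe_pctx E E' \<Longrightarrow> howe t t' \<Longrightarrow>
    howe (plug (ren_pctx \<rho> E) t) (plug (ren_pctx \<rho> E') t')"
proof (induction rule: howe_pctx.induct)
  case (AppR v w E E')
  then show ?case using howe_ren[OF AppR(1), of \<rho>] by (simp add: howe_compat)
next
  case (AppL E E' t u)
  then show ?case by (simp add: howe_compat howe_ren)
qed auto

lemma howe_reify: "howe_pctx E E' \<Longrightarrow> howe (Val (reify E)) (Val (reify E'))"
  unfolding reify_def by (intro howe_compat howe_plug_ren howe_refl)

text \<open>The right label must be closed because the answering transition carries it; closedness
  of the left one comes from the transition being answered.\<close>

inductive howe_label :: "label \<Rightarrow> label \<Rightarrow> bool" where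
  Tau: "howe_label Tau Tau"
| LVal: "howe (Val v) (Val w) \<Longrightarrow> closed_val w \<Longrightarrow> howe_label (LVal v) (LVal w)"
| LCtx: "howe_pctx E E' \<Longrightarrow> closed_pctx E' \<Longrightarrow> howe_label (LCtx E) (LCtx E')"

inductive_simps howe_label_simps [simp]:
  "howe_label Tau \<beta>" "howe_label (LVal v) \<beta>" "howe_label (LCtx E) \<beta>"

lemma howe_label_refl: "closed_label \<alpha> \<Longrightarrow> howe_label \<alpha> \<alpha>"
  by (cases \<alpha>) (auto intro: howe_refl howe_pctx_refl)

text \<open>Carries an answer found at the intermediate term \<open>r\<close> of a Howe step over to
  the final term \<open>u\<close>.\<close>

lemma howe_weak_lts_bisim:
  assumes "weak_lts r \<beta> r'" and "howe t' r'" and "(r, u) \<in> app_bisimilarity"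
  shows "\<exists>u'. weak_lts u \<beta> u' \<and> howe t' u'"
  using app_simulation_weak_lts[OF bisim_simulation assms(1,3)] assms(2) howe_bisim by blast

text \<open>Apart from the abstraction case, which uses \<open>howe_Lam\<close> directly, each case
  inverts the Howe step, builds an answer from the intermediate term, and transports it to
  \<open>u\<close> by \<open>howe_weak_lts_bisim\<close>.\<close>

lemma howe_lts:
  "lts t \<alpha> t' \<Longrightarrow> howe t u \<Longrightarrow> closed_trm u \<Longrightarrow> howe_label \<alpha> \<beta> \<Longrightarrow>
    \<exists>u'. weak_lts u \<beta> u' \<and> howe t' u'"
proof (induction arbitrary: u \<beta> rule: lts.induct)
  case (beta t v)
  obtain r s where rs: "howe (Val (Lam t)) r" "howe (Val v) s" "closed_trm r" "closed_trm s"
    "(App r s, u) \<in> app_bisimilarity"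
    using howe_closed_AppE beta by (metis closed_simps(1,2))
  obtain t' where t': "tau_steps r (Val (Lam t'))" "closed_val (Lam t')"
    and inst: "\<And>v w. howe (Val v) (Val w) \<Longrightarrow> closed_val w \<Longrightarrow> howe (inst t v) (inst t' w)"
    using howe_Lam[OF rs(1) beta(1) rs(3)] by metis
  obtain w where w: "tau_steps s (Val w)" "closed_val w" "howe (Val v) (Val w)"
    using howe_Val[OF rs(2) beta(2) rs(4)] .
  have "tau_steps (App r s) (inst t' w)"
    using tau_steps_App_vals[OF t'(1) w(1) rs(3,4)] lts.beta[OF t'(2) w(2)]
      tau_steps_trans tau_steps_step by blast
  then show ?case using howe_weak_lts_bisim[OF _ inst[OF w(3,2)] rs(5), of Tau] beta(5) by simp
next
  case (app_left t0 t0' t1)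
  have "closed_trm t0" using app_left(1) lts_closed by blast
  then obtain r s where rs: "howe t0 r" "howe t1 s" "closed_trm r" "closed_trm s"
    "(App r s, u) \<in> app_bisimilarity"
    using howe_closed_AppE app_left(2,4,5) by (metis closed_simps(2))
  obtain r' where r': "tau_steps r r'" "howe t0' r'"
    using app_left(3)[OF rs(1,3), of Tau] by auto
  show ?case
    using howe_weak_lts_bisim[OF _ howe_compat(2)[OF r'(2) rs(2)] rs(5), of Tau]
      tau_steps_App_left[OF r'(1) rs(4)] app_left(6) by simp
next
  case (app_right t t' v)
  have "closed_trm t" using app_right(1) lts_closed by blast
  then obtain r s where rs: "howe (Val v) r" "howe t s" "closed_trm r" "closed_trm s"
    "(App r s, u) \<in> app_bisimilarity"
    using howe_closed_AppE app_right(2,4,5) by (metis closed_simps(1,2))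
  obtain w where w: "tau_steps r (Val w)" "closed_val w" "howe (Val v) (Val w)"
    using howe_Val[OF rs(1) app_right(2) rs(3)] .
  obtain s' where s': "tau_steps s s'" "howe t' s'"
    using app_right(3)[OF rs(2,4), of Tau] by auto
  show ?case
    using howe_weak_lts_bisim[OF _ howe_compat(2)[OF w(3) s'(2)] rs(5), of Tau]
      tau_steps_App_vals[OF w(1) s'(1) rs(3,4)] app_right(6) by simp
next
  case (reset_val v)
  obtain r where r: "howe (Val v) r" "closed_trm r" "(Reset r, u) \<in> app_bisimilarity"
    using howe_closed_ResetE reset_val by (metis closed_simps(1,3))
  obtain w where w: "tau_steps r (Val w)" "closed_val w" "howe (Val v) (Val w)"
    using howe_Val[OF r(1) reset_val(1) r(2)] .
  have "tau_steps (Reset r) (Val w)"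
    using tau_steps_Reset[OF w(1)] lts.reset_val[OF w(2)] tau_steps_trans tau_steps_step by blast
  then show ?case using howe_weak_lts_bisim[OF _ w(3) r(3), of Tau] reset_val(4) by simp
next
  case (reset_step t t')
  have "closed_trm t" using reset_step(1) lts_closed by blast
  then obtain r where r: "howe t r" "closed_trm r" "(Reset r, u) \<in> app_bisimilarity"
    using howe_closed_ResetE reset_step(3,4) by (metis closed_simps(3))
  obtain r' where r': "tau_steps r r'" "howe t' r'"
    using reset_step(2)[OF r(1,2), of Tau] by auto
  show ?case
    using howe_weak_lts_bisim[OF _ howe_compat(4)[OF r'(2)] r(3), of Tau]
      tau_steps_Reset[OF r'(1)] reset_step(5) by simp
next
  case (reset_capture t t')
  have "closed_trm t" using reset_capture(1) lts_closed by blast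
  then obtain r where r: "howe t r" "closed_trm r" "(Reset r, u) \<in> app_bisimilarity"
    using howe_closed_ResetE reset_capture(3,4) by (metis closed_simps(3))
  \<comment> \<open>The label is related to itself, so \<open>r\<close> also captures the empty
    context, which becomes a \<tau>-step once a reset surrounds it.\<close>
  obtain x r' where r': "tau_steps r x" "lts x (LCtx Hole) r'" "howe t' r'"
    using reset_capture(2)[OF r(1,2), of "LCtx Hole"] howe_pctx_refl by auto
  have "tau_steps (Reset r) r'"
    using tau_steps_Reset[OF r'(1)] lts.reset_capture[OF r'(2)] tau_steps_trans tau_steps_step
    by blast
  then show ?case using howe_weak_lts_bisim[OF _ r'(3) r(3), of Tau] reset_capture(5) by simp
next
  case (lam t v)
  obtain w where w: "\<beta> = LVal w" "howe (Val v) (Val w)" "closed_val w"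
    using lam(5) by auto
  obtain s where s: "tau_steps u (Val (Lam s))" "closed_val (Lam s)"
    and inst: "\<And>v w. howe (Val v) (Val w) \<Longrightarrow> closed_val w \<Longrightarrow> howe (inst t v) (inst s w)"
    using howe_Lam[OF lam(3,1,4)] by metis
  show ?case using s lts.lam[OF s(2) w(3)] inst[OF w(2,3)] w(1) by auto
next
  case (shift t E)
  obtain E' where E': "\<beta> = LCtx E'" "howe_pctx E E'" "closed_pctx E'"
    using shift(5) by auto
  obtain s where s: "howe t s" "(Shift s, u) \<in> app_bisimilarity"
    using howe_closed_ShiftE[OF shift(3,1,4)] .
  \<comment> \<open>Related contexts reify to related values, so substitutivity handles the captured
    continuation.\<close>
  have "howe (Reset (inst t (reify E))) (Reset (inst s (reify E')))"
    using howe_compat(4) howe_inst s(1) howe_reify E'(2) by blast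
  moreover have "lts (Shift s) (LCtx E') (Reset (inst s (reify E')))"
    using lts.shift bisim_closed s(2) E'(3) by blast
  ultimately show ?case using howe_weak_lts_bisim[OF _ _ s(2)] E'(1)
    by (metis tau_steps_refl weak_lts_simps(3))
next
  case (ctx_left t0 E t1 t0')
  obtain E' where E': "\<beta> = LCtx E'" "howe_pctx E E'" "closed_pctx E'"
    using ctx_left(5) by auto
  have "closed_trm t0" "closed_trm t1" using ctx_left(1) lts_closed by fastforce+
  then obtain r s where rs: "howe t0 r" "howe t1 s" "closed_trm r" "closed_trm s"
    "(App r s, u) \<in> app_bisimilarity"
    using howe_closed_AppE ctx_left(3,4) by (metis closed_simps(2))
  \<comment> \<open>The operator now captures different contexts on the two sides: the added frame
    holds \<open>t1\<close> on the left and \<open>s\<close> on the right.\<close>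
  have "howe_pctx (comp_pctx E (AppL Hole t1)) (comp_pctx E' (AppL Hole s))"
    by (intro howe_pctx_comp howe_pctx.intros E'(2) rs(2))
  then obtain x r' where r': "tau_steps r x" "lts x (LCtx (comp_pctx E' (AppL Hole s))) r'"
    "howe t0' r'"
    using ctx_left(2)[OF rs(1,3), of "LCtx (comp_pctx E' (AppL Hole s))"] E'(3) rs(4) by auto
  have "weak_lts (App r s) \<beta> r'"
    using tau_steps_App_left[OF r'(1) rs(4)] lts.ctx_left[OF r'(2)] E'(1) by auto
  then show ?case using howe_weak_lts_bisim[OF _ r'(3) rs(5)] by blast
next
  case (ctx_right t E v t')
  obtain E' where E': "\<beta> = LCtx E'" "howe_pctx E E'" "closed_pctx E'"
    using ctx_right(5) by auto
  have cl: "closed_trm t" "closed_val v" using ctx_right(1) lts_closed by fastforce+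
  then obtain r s where rs: "howe (Val v) r" "howe t s" "closed_trm r" "closed_trm s"
    "(App r s, u) \<in> app_bisimilarity"
    using howe_closed_AppE ctx_right(3,4) by (metis closed_simps(1,2))
  \<comment> \<open>The operator must first be run to a value, as only a value can form an
    \<open>AppR\<close> frame.\<close>
  obtain w where w: "tau_steps r (Val w)" "closed_val w" "howe (Val v) (Val w)"
    using howe_Val[OF rs(1) cl(2) rs(3)] .
  have "howe_pctx (comp_pctx E (AppR v Hole)) (comp_pctx E' (AppR w Hole))"
    by (intro howe_pctx_comp howe_pctx.intros E'(2) w(3))
  then obtain x s' where s': "tau_steps s x" "lts x (LCtx (comp_pctx E' (AppR w Hole))) s'"
    "howe t' s'"
    using ctx_right(2)[OF rs(2,4), of "LCtx (comp_pctx E' (AppR w Hole))"] E'(3) w(2) by auto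
  have "weak_lts (App r s) \<beta> s'"
    using tau_steps_App_vals[OF w(1) s'(1) rs(3,4)] lts.ctx_right[OF s'(2)] E'(1) by auto
  then show ?case using howe_weak_lts_bisim[OF _ s'(3) rs(5)] by blast
qed

definition howe_closed :: "(trm \<times> trm) set" where
  "howe_closed = {(t, u). howe t u \<and> closed_trm t \<and> closed_trm u}"

lemma howe_closed_simulation: "app_simulation howe_closed"
  unfolding app_simulation_def
proof (intro conjI allI impI)
  show "howe_closed \<subseteq> {t. closed_trm t} \<times> {t. closed_trm t}"
    by (auto simp: howe_closed_def)
next
  fix t0 t1 \<alpha> t0' assume "(t0, t1) \<in> howe_closed" and step: "lts t0 \<alpha> t0'"
  then have t: "howe t0 t1" "closed_trm t1" by (auto simp: howe_closed_def)
  obtain t1' where "weak_lts t1 \<alpha> t1'" "howe t0' t1'"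
    using howe_lts[OF step t] howe_label_refl lts_closed[OF step] by blast
  then show "\<exists>t1'. weak_lts t1 \<alpha> t1' \<and> (t0', t1') \<in> howe_closed"
    using weak_lts_closed t(2) lts_closed[OF step] by (auto simp: howe_closed_def)
qed

section \<open>Symmetry of the transitive closure\<close>

lemma tranclp_howe_map:
  assumes "howe\<^sup>+\<^sup>+ t u" and "\<And>t u. howe t u \<Longrightarrow> howe (f t) (f u)"
  shows "howe\<^sup>+\<^sup>+ (f t) (f u)"
  using assms(1) by (induction rule: tranclp_induct) (auto intro: assms(2) tranclp.trancl_into_trancl)

lemma tranclp_howe_App:
  assumes "howe\<^sup>+\<^sup>+ t t'" and "howe\<^sup>+\<^sup>+ s s'"
  shows "howe\<^sup>+\<^sup>+ (App t s) (App t' s')"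
proof -
  have "howe\<^sup>+\<^sup>+ (App t s) (App t' s)"
    using assms(1) by (rule tranclp_howe_map[where f = "\<lambda>t. App t s"]) (simp add: howe_compat howe_refl)
  moreover have "howe\<^sup>+\<^sup>+ (App t' s) (App t' s')"
    using assms(2) by (rule tranclp_howe_map[where f = "App t'"]) (simp add: howe_compat howe_refl)
  ultimately show ?thesis by (rule tranclp_trans)
qed

lemma obisim_tranclp_howe: "u \<approx>\<degree> t \<Longrightarrow> howe\<^sup>+\<^sup>+ u s \<Longrightarrow> howe\<^sup>+\<^sup>+ t s"
  using obisim_howe obisim_sym tranclp_into_tranclp2 by metis

text \<open>Reversal puts the \<open>\<approx>\<degree>\<close> step, which is symmetric, first and
  the reversed compatible step second. This order is not a single Howe step but is a chain of
  them.\<close>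

lemma tranclp_howe_sym: "howe t u \<Longrightarrow> howe\<^sup>+\<^sup>+ u t"
proof (induction rule: howe.induct)
  case (Var n u)
  then show ?case using obisim_howe obisim_sym by blast
next
  case (Lam t t' u)
  have "howe\<^sup>+\<^sup>+ (Val (Lam t')) (Val (Lam t))"
    using Lam(3) by (rule tranclp_howe_map[where f = "\<lambda>t. Val (Lam t)"]) (rule howe_compat)
  then show ?case using obisim_tranclp_howe Lam(2) by blast
next
  case (App t t' s s' u)
  then show ?case using obisim_tranclp_howe tranclp_howe_App by blast
next
  case (Shift t t' u)
  have "howe\<^sup>+\<^sup>+ (Shift t') (Shift t)"
    using Shift(3) by (rule tranclp_howe_map) (rule howe_compat)
  then show ?case using obisim_tranclp_howe Shift(2) by blast
next
  case (Reset t t' u)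
  have "howe\<^sup>+\<^sup>+ (Reset t') (Reset t)"
    using Reset(3) by (rule tranclp_howe_map) (rule howe_compat)
  then show ?case using obisim_tranclp_howe Reset(2) by blast
qed

text \<open>A chain between closed terms may pass through open ones; closing every link by the same
  substitution keeps the two ends.\<close>

lemma tranclp_howe_close:
  assumes "howe\<^sup>+\<^sup>+ t u" and "closed_trm t" and "closed_trm u"
  shows "(t, u) \<in> howe_closed\<^sup>+"
proof -
  let ?c = "subst_trm (\<lambda>_. id_val)"
  have step: "(?c t, ?c u) \<in> howe_closed" if "howe t u" for t u
    using howe_close[OF that] closed_subst by (simp add: howe_closed_def)
  have "(?c t, ?c u) \<in> howe_closed\<^sup>+"
    using assms(1) by (induction rule: tranclp_induct) (auto intro: step trancl_into_trancl)
  then show ?thesis using assms(2,3) by (simp add: subst_closed)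
qed

lemma howe_closed_trancl_sym: "(howe_closed\<^sup>+)\<inverse> = howe_closed\<^sup>+"
proof -
  have "(u, t) \<in> howe_closed\<^sup>+" if "(t, u) \<in> howe_closed" for t u
    using that tranclp_howe_sym tranclp_howe_close by (auto simp: howe_closed_def)
  then have "howe_closed\<inverse> \<subseteq> howe_closed\<^sup>+" by auto
  then have "(howe_closed\<inverse>)\<^sup>+ \<subseteq> howe_closed\<^sup>+"
    by (metis trancl_mono_subset trancl_id trans_trancl)
  then have "(howe_closed\<^sup>+)\<inverse> \<subseteq> howe_closed\<^sup>+" by (simp only: trancl_converse)
  \<comment> \<open>Taking converses of both sides turns the inclusion into its reverse.\<close>
  then show ?thesis by (metis converse_converse converse_mono subset_antisym)
qed

section \<open>The Howe closure coincides with the open extension\<close>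

lemma howe_closed_bisim: "howe_closed \<subseteq> app_bisimilarity"
proof -
  have "app_bisimulation (howe_closed\<^sup>+)"
    unfolding app_bisimulation_def howe_closed_trancl_sym
    using app_simulation_trancl[OF howe_closed_simulation] by simp
  then show ?thesis using app_bisimilarity_greatest r_into_trancl by fast
qed

lemma howe_iff_obisim: "howe t u \<longleftrightarrow> t \<approx>\<degree> u"
proof
  assume "howe t u"
  \<comment> \<open>Substitutivity with the same closing substitution on both sides reduces open
    terms to closed ones.\<close>
  then have "(subst_trm \<sigma> t, subst_trm \<sigma> u) \<in> howe_closed" if "\<forall>n. closed_val (\<sigma> n)" for \<sigma>
    using that howe_subst[OF _ howe_refl(1)] closed_subst unfolding howe_closed_def by blast
  then show "t \<approx>\<degree> u" using howe_closed_bisim by (auto simp: open_ext_iff)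
qed (rule obisim_howe)

theorem theorem4p14:
  shows "equiv {t. closed_trm t} app_bisimilarity \<and> compatible (open_ext app_bisimilarity)"
  using equiv_bisim howe_compat unfolding compatible_def howe_iff_obisim by blast

end
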